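(* If a metric space $M$ contains a bilipschitz copy of the unit sphere $S_{c_0}$ of $c_0$, then $\mathrm{Lip}_0(M)$ is not a Grothendieck space.
   Context: All vector spaces are real. A Banach space $X$ is a Grothendieck space if every weak* convergent sequence in $X^*$ converges weakly. For a metric space $(M,\rho)$ with a distinguished base point $e$, $\mathrm{Lip}_0(M)$ is the Banach space of all Lipschitz functions $f\colon M\to\mathbb{R}$ with $f(e)=0$, with norm $\|f\|=\mathrm{Lip}(f)=\sup_{x\neq y}|f(x)-f(y)|/\rho(x,y)$. $S_{c_0}=\{x\in c_0\colon\|x\|_\infty=1\}$ carries the metric induced by the norm. *)

theory Defs
  imports "HOL-Analysis.Analysis"
begin

section \<open>Grothendieck spaces\<close>

text \<open>The dual of \<open>'a\<close> is \<open>'a \<Rightarrow>\<^sub>L real\<close>. For functionals the library's strong operator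
  topology (pointwise convergence on \<open>'a\<close>) is the weak* topology.\<close>

abbreviation weak_star_topology :: "('a::real_normed_vector \<Rightarrow>\<^sub>L real) topology" where
  "weak_star_topology \<equiv> strong_operator_topology"

definition weak_topology :: "'a::real_normed_vector topology" where
  "weak_topology = pullback_topology UNIV (\<lambda>x (\<phi> :: 'a \<Rightarrow>\<^sub>L real). blinfun_apply \<phi> x) euclidean"

definition Grothendieck_space :: "'a::banach itself \<Rightarrow> bool" where
  "Grothendieck_space TYPE('a) \<longleftrightarrow>
    (\<forall>\<phi> :: nat \<Rightarrow> 'a \<Rightarrow>\<^sub>L real.
      (\<exists>\<psi>. limitin weak_star_topology \<phi> \<psi> sequentially) \<longrightarrow>
      (\<exists>\<psi>. limitin weak_topology \<phi> \<psi> sequentially))"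

lemma limitin_pullback_iff:
  "limitin (pullback_topology UNIV f euclidean) X l F \<longleftrightarrow> ((\<lambda>n. f (X n)) \<longlongrightarrow> f l) F"
  unfolding limitin_def tendsto_def openin_pullback_topology topspace_pullback_topology
  by auto

lemma tendsto_fun_iff:
  fixes X :: "'i \<Rightarrow> 'a \<Rightarrow> 'b::topological_space"
  shows "(X \<longlongrightarrow> l) F \<longleftrightarrow> (\<forall>i. ((\<lambda>n. X n i) \<longlongrightarrow> l i) F)"
  using limitin_componentwise[of "\<lambda>_. euclidean" UNIV X l F]
  by (simp add: euclidean_product_topology)

lemma limitin_weak_star_topology_iff:
  fixes \<phi> :: "'i \<Rightarrow> 'a::real_normed_vector \<Rightarrow>\<^sub>L real"
  shows "limitin weak_star_topology \<phi> \<psi> F \<longleftrightarrow> (\<forall>x. ((\<lambda>n. \<phi> n x) \<longlongrightarrow> \<psi> x) F)"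
  by (simp add: strong_operator_topology_def limitin_pullback_iff tendsto_fun_iff)

lemma limitin_weak_topology_iff:
  fixes X :: "'i \<Rightarrow> 'a::real_normed_vector"
  shows "limitin weak_topology X l F \<longleftrightarrow>
    (\<forall>\<phi> :: 'a \<Rightarrow>\<^sub>L real. ((\<lambda>n. \<phi> (X n)) \<longlongrightarrow> \<phi> l) F)"
  by (simp add: weak_topology_def limitin_pullback_iff tendsto_fun_iff)


section \<open>The Banach space of Lipschitz functions vanishing at the base point\<close>

text \<open>The base point is a class parameter, so that it is an arbitrary point fixed along with the
  metric and the Lipschitz functions vanishing at it can form a type.\<close>

class pointed_metric_space = metric_space +
  fixes base_point :: 'a

typedef (overloaded) 'a lip0 =
  "{f :: 'a::pointed_metric_space \<Rightarrow> real. f base_point = 0 \<and> (\<exists>L. L-lipschitz_on UNIV f)}"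
  morphisms lip0_apply Lip0
  by (rule exI[of _ "\<lambda>_. 0"]) (auto intro: lipschitz_on_constant)

setup_lifting type_definition_lip0

lemma lip0_eqI: "(\<And>x. lip0_apply f x = lip0_apply g x) \<Longrightarrow> f = g"
  by (simp add: lip0_apply_inject[symmetric] fun_eq_iff)

text \<open>The supremum below runs over all pairs: a diagonal pair contributes \<open>0 / 0 = 0\<close>, so that
  the set of quotients is nonempty also when the space has only one point.\<close>

definition lip_const :: "('a::metric_space \<Rightarrow> real) \<Rightarrow> real" where
  "lip_const f = (SUP (x, y). \<bar>f x - f y\<bar> / dist x y)"

lemma lip_quotient_le:
  assumes "L-lipschitz_on UNIV f"
  shows "(case p of (x, y) \<Rightarrow> \<bar>f x - f y\<bar> / dist x y) \<le> L"
  using lipschitz_onD[OF assms, of "fst p" "snd p"] lipschitz_on_nonneg[OF assms]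
  by (cases "fst p = snd p") (auto simp: split_beta dist_real_def field_simps)

lemma lip_const_le: "L-lipschitz_on UNIV f \<Longrightarrow> lip_const f \<le> L"
  unfolding lip_const_def by (intro cSUP_least lip_quotient_le) auto

lemma lip_quotient_le_lip_const:
  assumes "L-lipschitz_on UNIV f"
  shows "\<bar>f x - f y\<bar> / dist x y \<le> lip_const f"
proof -
  have "bdd_above (range (\<lambda>(x, y). \<bar>f x - f y\<bar> / dist x y))"
    using lip_quotient_le[OF assms] by (rule bdd_aboveI2)
  from cSUP_upper[OF _ this, of "(x, y)"] show ?thesis
    by (simp add: lip_const_def)
qed

lemma lip_const_upper:
  "L-lipschitz_on UNIV f \<Longrightarrow> \<bar>f x - f y\<bar> \<le> lip_const f * dist x y"
  using lip_quotient_le_lip_const[of L f x y] by (cases "x = y") (auto simp: field_simps)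

lemma lip_const_nonneg: "L-lipschitz_on UNIV f \<Longrightarrow> 0 \<le> lip_const f"
  using lip_quotient_le_lip_const[of L f undefined undefined] by simp

lemma lipschitz_on_lip_const:
  "L-lipschitz_on UNIV f \<Longrightarrow> (lip_const f)-lipschitz_on UNIV f"
  using lip_const_upper[of L f] lip_const_nonneg[of L f]
  by (intro lipschitz_onI) (auto simp: dist_real_def)

instantiation lip0 :: (pointed_metric_space) real_normed_vector
begin

lift_definition norm_lip0 :: "'a lip0 \<Rightarrow> real" is lip_const .

lift_definition zero_lip0 :: "'a lip0" is "\<lambda>x. 0"
  by (auto intro: lipschitz_on_constant)

lift_definition uminus_lip0 :: "'a lip0 \<Rightarrow> 'a lip0" is "\<lambda>f x. - f x"
  by (auto intro: lipschitz_on_minus)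

lift_definition plus_lip0 :: "'a lip0 \<Rightarrow> 'a lip0 \<Rightarrow> 'a lip0" is "\<lambda>f g x. f x + g x"
  by (auto intro: lipschitz_on_add)

lift_definition minus_lip0 :: "'a lip0 \<Rightarrow> 'a lip0 \<Rightarrow> 'a lip0" is "\<lambda>f g x. f x - g x"
  by (auto intro: lipschitz_on_diff)

lift_definition scaleR_lip0 :: "real \<Rightarrow> 'a lip0 \<Rightarrow> 'a lip0" is "\<lambda>r f x. r * f x"
  by (auto intro: lipschitz_on_cmult_real)

definition dist_lip0 :: "'a lip0 \<Rightarrow> 'a lip0 \<Rightarrow> real"
  where "dist_lip0 f g = norm (f - g)"

definition uniformity_lip0 :: "('a lip0 \<times> 'a lip0) filter"
  where "uniformity_lip0 = (INF e\<in>{0 <..}. principal {(f, g). dist f g < e})"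

definition open_lip0 :: "'a lip0 set \<Rightarrow> bool"
  where "open_lip0 S = (\<forall>f\<in>S. \<forall>\<^sub>F (f', g) in uniformity. f' = f \<longrightarrow> g \<in> S)"

definition sgn_lip0 :: "'a lip0 \<Rightarrow> 'a lip0"
  where "sgn_lip0 f = inverse (norm f) *\<^sub>R f"

instance
proof
  fix a b :: real and f g h :: "'a lip0"
  show "f + g + h = f + (g + h)" "f + g = g + f" "0 + f = f" "- f + f = 0" "f - g = f + - g"
    by (transfer; simp add: fun_eq_iff)+
  show "a *\<^sub>R (f + g) = a *\<^sub>R f + a *\<^sub>R g" "(a + b) *\<^sub>R f = a *\<^sub>R f + b *\<^sub>R f"
    "a *\<^sub>R b *\<^sub>R f = (a * b) *\<^sub>R f" "1 *\<^sub>R f = f"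
    by (transfer; simp add: fun_eq_iff algebra_simps)+
  show "dist f g = norm (f - g)" "sgn f = inverse (norm f) *\<^sub>R f"
    by (simp_all add: dist_lip0_def sgn_lip0_def)
  show "(uniformity :: ('a lip0 \<times> 'a lip0) filter) =
      (INF e\<in>{0 <..}. principal {(f, g). dist f g < e})"
    by (rule uniformity_lip0_def)
  show "open U = (\<forall>f\<in>U. \<forall>\<^sub>F (f', g) in uniformity. f' = f \<longrightarrow> g \<in> U)" for U :: "'a lip0 set"
    by (rule open_lip0_def)
  show "norm f = 0 \<longleftrightarrow> f = 0"
  proof (transfer, safe)
    fix f :: "'a \<Rightarrow> real" and L
    assume "f base_point = 0" "L-lipschitz_on UNIV f" "lip_const f = 0"
    with lip_const_upper[of L f _ base_point] show "f = (\<lambda>x. 0)" by (auto simp: fun_eq_iff)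
  next
    show "lip_const (\<lambda>x::'a. 0) = 0" by (simp add: lip_const_def)
  qed
  show "norm (f + g) \<le> norm f + norm g"
  proof (transfer, safe)
    fix f g :: "'a \<Rightarrow> real" and K L
    assume "K-lipschitz_on UNIV f" "L-lipschitz_on UNIV g"
    then show "lip_const (\<lambda>x. f x + g x) \<le> lip_const f + lip_const g"
      by (intro lip_const_le lipschitz_on_add lipschitz_on_lip_const)
  qed
  have le: "norm (c *\<^sub>R k) \<le> \<bar>c\<bar> * norm k" for c and k :: "'a lip0"
  proof (transfer, safe)
    fix c L and k :: "'a \<Rightarrow> real"
    assume "L-lipschitz_on UNIV k"
    then show "lip_const (\<lambda>x. c * k x) \<le> \<bar>c\<bar> * lip_const k"
      by (intro lip_const_le lipschitz_on_cmult_real lipschitz_on_lip_const)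
  qed
  have sc: "c *\<^sub>R d *\<^sub>R k = (c * d) *\<^sub>R k" "1 *\<^sub>R k = k" for c d and k :: "'a lip0"
    by (transfer; simp add: fun_eq_iff)+
  show "norm (a *\<^sub>R f) = \<bar>a\<bar> * norm f"
  proof (cases "a = 0")
    case True
    have "0 \<le> norm (a *\<^sub>R f)" by transfer (auto intro: lip_const_nonneg lipschitz_on_cmult_real)
    with le[of a f] True show ?thesis by simp
  next
    case False
    then have "norm f \<le> \<bar>inverse a\<bar> * norm (a *\<^sub>R f)"
      using le[of "inverse a" "a *\<^sub>R f"] by (simp add: sc)
    with False le[of a f] show ?thesis by (simp add: field_simps abs_inverse)
  qed
qed

end

lemma lip0_apply_base_point [simp]: "lip0_apply f base_point = 0"
  by transfer auto

lemma lip0_apply_diff: "lip0_apply (f - g) x = lip0_apply f x - lip0_apply g x"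
  by transfer simp

lemma lip0_lipschitz: "\<bar>lip0_apply f x - lip0_apply f y\<bar> \<le> norm f * dist x y"
  by transfer (auto intro: lip_const_upper)

lemma norm_lip0_le:
  assumes "0 \<le> L" and "\<And>x y. \<bar>lip0_apply f x - lip0_apply f y\<bar> \<le> L * dist x y"
  shows "norm f \<le> L"
  using assms by transfer (auto intro!: lip_const_le lipschitz_onI simp: dist_real_def)

instance lip0 :: (pointed_metric_space) banach
proof
  fix X :: "nat \<Rightarrow> 'a lip0"
  assume X: "Cauchy X"
  have "Cauchy (\<lambda>n. lip0_apply (X n) x)" for x
  proof (rule metric_CauchyI)
    fix e :: real assume "0 < e"
    define d where "d = e / (dist x base_point + 1)"
    have "0 < d" using \<open>0 < e\<close> by (simp add: d_def add_nonneg_pos)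
    then obtain N where N: "\<And>m n. m \<ge> N \<Longrightarrow> n \<ge> N \<Longrightarrow> norm (X m - X n) < d"
      using X by (metis Cauchy_def dist_norm)
    have "dist (lip0_apply (X m) x) (lip0_apply (X n) x) < e" if "m \<ge> N" "n \<ge> N" for m n
    proof -
      have "\<bar>lip0_apply (X m) x - lip0_apply (X n) x\<bar> \<le> norm (X m - X n) * dist x base_point"
        using lip0_lipschitz[of "X m - X n" x base_point] by (simp add: lip0_apply_diff)
      also have "\<dots> \<le> d * dist x base_point"
        using N[OF that] by (intro mult_right_mono) auto
      also have "\<dots> < d * (dist x base_point + 1)" using \<open>0 < d\<close> by simp
      also have "\<dots> = e" unfolding d_def
        by (simp add: add_nonneg_eq_0_iff)
      finally show ?thesis by (simp add: dist_real_def)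
    qed
    then show "\<exists>N. \<forall>m\<ge>N. \<forall>n\<ge>N. dist (lip0_apply (X m) x) (lip0_apply (X n) x) < e" by blast
  qed
  then have "\<forall>x. \<exists>l. (\<lambda>n. lip0_apply (X n) x) \<longlonglongrightarrow> l"
    by (simp add: Cauchy_convergent_iff convergent_def)
  then obtain g where g: "\<And>x. (\<lambda>n. lip0_apply (X n) x) \<longlonglongrightarrow> g x" by metis
  obtain B where B: "\<And>n. norm (X n) \<le> B" "0 < B"
    using cauchy_imp_bounded[OF X] by (auto simp: bounded_pos)
  have gL: "\<bar>g x - g y\<bar> \<le> B * dist x y" for x y
  proof (rule tendsto_upperbound)
    show "(\<lambda>n. \<bar>lip0_apply (X n) x - lip0_apply (X n) y\<bar>) \<longlonglongrightarrow> \<bar>g x - g y\<bar>"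
      by (intro tendsto_intros g)
    show "\<forall>\<^sub>F n in sequentially. \<bar>lip0_apply (X n) x - lip0_apply (X n) y\<bar> \<le> B * dist x y"
      using order_trans[OF lip0_lipschitz mult_right_mono[OF B(1)]] by simp
  qed simp
  have "g base_point = 0"
    using g[of base_point] by (simp add: LIMSEQ_const_iff)
  moreover have "B-lipschitz_on UNIV g"
    using gL B(2) by (intro lipschitz_onI) (auto simp: dist_real_def)
  ultimately obtain G :: "'a lip0" where G: "lip0_apply G = g"
    using Lip0_inverse[of g] by blast
  have "X \<longlonglongrightarrow> G"
  proof (rule LIMSEQ_I)
    fix e :: real assume "0 < e"
    then obtain N where N: "\<And>m n. m \<ge> N \<Longrightarrow> n \<ge> N \<Longrightarrow> norm (X m - X n) < e / 2"
      using X by (metis Cauchy_def dist_norm half_gt_zero)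
    have "norm (X m - G) < e" if "m \<ge> N" for m
    proof -
      have "norm (X m - G) \<le> e / 2"
      proof (rule norm_lip0_le)
        fix x y
        show "\<bar>lip0_apply (X m - G) x - lip0_apply (X m - G) y\<bar> \<le> e / 2 * dist x y"
        proof (rule tendsto_upperbound)
          show "(\<lambda>n. \<bar>lip0_apply (X m - X n) x - lip0_apply (X m - X n) y\<bar>)
              \<longlonglongrightarrow> \<bar>lip0_apply (X m - G) x - lip0_apply (X m - G) y\<bar>"
            unfolding lip0_apply_diff G by (intro tendsto_intros g)
          show "\<forall>\<^sub>F n in sequentially.
              \<bar>lip0_apply (X m - X n) x - lip0_apply (X m - X n) y\<bar> \<le> e / 2 * dist x y"
            using eventually_ge_at_top[of N]
          proof eventually_elim
            case (elim n)
            show ?case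
              using lip0_lipschitz[of "X m - X n" x y]
                mult_right_mono[OF less_imp_le[OF N[OF that elim]], of "dist x y"] by simp
          qed
        qed simp
      qed (use \<open>0 < e\<close> in simp)
      with \<open>0 < e\<close> show ?thesis by simp
    qed
    then show "\<exists>N. \<forall>m\<ge>N. norm (X m - G) < e" by blast
  qed
  then show "convergent X" by (auto simp: convergent_def)
qed


section \<open>Bilipschitz embeddings and the unit sphere of \<open>c\<^sub>0\<close>\<close>

definition bilipschitz_embedding_on ::
  "'a::metric_space set \<Rightarrow> ('a \<Rightarrow> 'b::metric_space) \<Rightarrow> bool" where
  "bilipschitz_embedding_on S f \<longleftrightarrow>
    (\<exists>c>0. \<exists>C>0. \<forall>x\<in>S. \<forall>y\<in>S. c * dist x y \<le> dist (f x) (f y) \<and> dist (f x) (f y) \<le> C * dist x y)"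

text \<open>As \<open>nat\<close> is discrete, \<open>nat \<Rightarrow>\<^sub>C real\<close> is the space of all bounded real sequences with the
  supremum norm.\<close>

definition c0 :: "(nat \<Rightarrow>\<^sub>C real) set" where
  "c0 = {x. apply_bcontfun x \<longlonglongrightarrow> 0}"

definition c0_unit_sphere :: "(nat \<Rightarrow>\<^sub>C real) set" where
  "c0_unit_sphere = {x \<in> c0. norm x = 1}"

end

theory Submission
  imports Defs
begin

text \<open>
  The reason is that \<open>\<ell>\<^sub>1 = c\<^sub>0\<^sup>*\<close> is a quotient of \<open>Lip\<^sub>0(M)\<close>, whereas separable quotients of a
  Grothendieck space are reflexive. \<open>not_Grothendieck_of_l1_quotient\<close> is the concrete form of this
  obstruction: it asks for functionals \<open>D k\<close> on \<open>Lip\<^sub>0(M)\<close> whose finite sums are uniformly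
  bounded and a bounded sequence \<open>v\<close> that is biorthogonal to them.

  The sphere of \<open>c\<^sub>0\<close> contains the flat face of all sequences with first entry 1, a translate of
  the unit ball of \<open>c\<^sub>0\<close>; so a Lipschitz function on \<open>M\<close> can be differentiated along the remaining
  coordinates. The functional \<open>D k\<close> is an averaged partial derivative: the mean of the difference
  quotients in direction \<open>k\<close> over the grid of mesh \<open>1 / m\<close> in the cube of the first \<open>m\<close> coordinates,
  passed to a limit as \<open>m \<rightarrow> \<infinity>\<close>. The limit is taken along a filter for which all bounded sequences
  converge, so that it is linear.

  Derivatives of a Lipschitz function at a single point need not be additive in the direction, so
  they give no control over sums of the \<open>D k\<close>. Averaging makes the derivative additive, since translating a large grid box by a few
  steps changes an average only slightly. Therefore \<open>\<Sum>k\<in>A. D k f\<close> is an averaged derivative in the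
  direction \<open>\<Sum>k\<in>A. e\<^sub>k\<close>, which has norm 1 in \<open>c\<^sub>0\<close> for every nonempty finite \<open>A\<close>, and is bounded
  by a constant times \<open>\<parallel>f\<parallel>\<close> that does not depend on \<open>A\<close> (\<open>abs_sum_mean_slope_le\<close>). The biorthogonal sequence consists of the
  coordinate functions, transported to the copy of the sphere and extended to \<open>M\<close> by McShane's
  formula.
\<close>

section \<open>Limits along an ultrafilter\<close>

text \<open>Any ultrafilter finer than \<open>F\<close> would do. Tychonoff's theorem gives such a filter directly: the
  evaluations \<open>\<lambda>s. s x\<close> at the points \<open>x\<close> lie in a product of compact intervals, one for each
  bounded function \<open>s\<close>, and \<open>G\<close> is the trace on \<open>F\<close> of the neighbourhoods of a cluster point.\<close>

lemma finer_filter_bounded_functions_converge: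
  fixes F :: "'a filter"
  assumes "F \<noteq> bot"
  obtains G where "G \<le> F" "G \<noteq> bot"
    "\<And>s :: 'a \<Rightarrow> real. bounded (range s) \<Longrightarrow> \<exists>l. (s \<longlongrightarrow> l) G"
proof -
  have "\<exists>r\<ge>0. bounded (range s) \<longrightarrow> (\<forall>x. \<bar>s x\<bar> \<le> r)" for s :: "'a \<Rightarrow> real"
    by (metis abs_ge_zero bounded_real order.refl order_trans rangeI)
  then obtain r :: "('a \<Rightarrow> real) \<Rightarrow> real"
    where r: "\<And>s. 0 \<le> r s" "\<And>s x. bounded (range s) \<Longrightarrow> \<bar>s x\<bar> \<le> r s"
    by metis
  define K where "K = Pi\<^sub>E UNIV (\<lambda>s. {- r s .. r s})"
  \<comment> \<open>Unbounded functions get the dummy value 0, so that every coordinate stays in its interval.\<close>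
  define e where "e x s = (if bounded (range s) then s x else 0)" for x :: 'a and s :: "'a \<Rightarrow> real"
  have "compactin (product_topology (\<lambda>_. euclidean) UNIV) K"
    unfolding K_def by (simp add: compactin_PiE compactin_euclidean_iff)
  then have "compact K"
    by (simp add: euclidean_product_topology compactin_euclidean_iff)
  moreover have "e x \<in> K" for x
    using r by (auto simp: K_def e_def abs_le_iff minus_le_iff)
  then have "eventually (\<lambda>y. y \<in> K) (filtermap e F)"
    by (simp add: eventually_filtermap)
  moreover have "filtermap e F \<noteq> bot"
    using assms by (simp add: filtermap_bot_iff)
  ultimately obtain h where h: "inf (nhds h) (filtermap e F) \<noteq> bot"
    unfolding compact_filter by blast
  define G where "G = inf F (filtercomap e (nhds h))"
  show thesis
  proof
    show "G \<le> F" by (simp add: G_def)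
    show "G \<noteq> bot"
    proof
      assume "G = bot"
      then have "eventually (\<lambda>_. False) G" by simp
      then obtain P Q where PQ: "eventually P F" "eventually Q (filtercomap e (nhds h))"
        "\<And>x. P x \<Longrightarrow> Q x \<Longrightarrow> False"
        unfolding G_def eventually_inf by blast
      then obtain R where R: "eventually R (nhds h)" "\<And>x. R (e x) \<Longrightarrow> Q x"
        unfolding eventually_filtercomap by blast
      have "eventually (\<lambda>y. \<not> R y) (filtermap e F)"
        unfolding eventually_filtermap using PQ(1) by eventually_elim (use PQ(3) R(2) in blast)
      with R(1) have "eventually (\<lambda>_. False) (inf (nhds h) (filtermap e F))"
        unfolding eventually_inf by blast
      with h show False by (simp add: eventually_False)
    qed
    have "(e \<longlongrightarrow> h) (filtercomap e (nhds h))"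
      by (rule filterlim_filtercomap)
    then have "(e \<longlongrightarrow> h) G"
      unfolding G_def by (rule filterlim_mono) auto
    then have e: "((\<lambda>x. e x s) \<longlongrightarrow> h s) G" for s
      by (simp add: tendsto_fun_iff)
    fix s :: "'a \<Rightarrow> real"
    assume "bounded (range s)"
    then have "(\<lambda>x. e x s) = s" by (simp add: e_def fun_eq_iff)
    with e[of s] show "\<exists>l. (s \<longlongrightarrow> l) G" by auto
  qed
qed

text \<open>This is how weak* compactness of dual balls is used below: one filter, fixed in advance,
  serves for all bounded families of functionals at once.\<close>

lemma limit_of_bounded_functionals:
  fixes T :: "'i \<Rightarrow> 'a::real_normed_vector \<Rightarrow> real"
  assumes G: "G \<noteq> bot" "\<And>s :: 'i \<Rightarrow> real. bounded (range s) \<Longrightarrow> \<exists>l. (s \<longlongrightarrow> l) G"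
    and T: "\<And>i. linear (T i)" "\<And>i x. \<bar>T i x\<bar> \<le> K * norm x"
  obtains U :: "'a \<Rightarrow>\<^sub>L real" where "\<And>x. ((\<lambda>i. T i x) \<longlongrightarrow> U x) G"
proof -
  have "\<exists>l. ((\<lambda>i. T i x) \<longlongrightarrow> l) G" for x
    by (rule G(2), rule boundedI[where B = "K * norm x"]) (use T(2) in auto)
  then obtain u where u: "\<And>x. ((\<lambda>i. T i x) \<longlongrightarrow> u x) G"
    by metis
  have "bounded_linear u"
  proof (rule bounded_linear_intro)
    show "u (x + y) = u x + u y" for x y
    proof (rule tendsto_unique[OF G(1) u])
      show "((\<lambda>i. T i (x + y)) \<longlongrightarrow> u x + u y) G"
        unfolding linear_add[OF T(1)] by (intro tendsto_add u)
    qed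
    show "u (c *\<^sub>R x) = c *\<^sub>R u x" for c x
    proof (rule tendsto_unique[OF G(1) u])
      show "((\<lambda>i. T i (c *\<^sub>R x)) \<longlongrightarrow> c *\<^sub>R u x) G"
        unfolding linear_scale[OF T(1)] by (intro tendsto_scaleR tendsto_const u)
    qed
    show "norm (u x) \<le> norm x * K" for x
    proof (rule tendsto_upperbound[OF _ _ G(1)])
      show "((\<lambda>i. norm (T i x)) \<longlongrightarrow> norm (u x)) G"
        by (intro tendsto_norm u)
      show "\<forall>\<^sub>F i in G. norm (T i x) \<le> norm x * K"
        using T(2) by (simp add: mult.commute)
    qed
  qed
  then show thesis
    using that[of "Blinfun u"] u by (simp add: bounded_linear_Blinfun_apply)
qed


section \<open>Quotients isomorphic to \<open>\<ell>\<^sub>1\<close>\<close>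

lemma summable_abs_of_bounded_finite_sums:
  fixes a :: "nat \<Rightarrow> real"
  assumes "\<And>A. finite A \<Longrightarrow> \<bar>sum a A\<bar> \<le> K"
  shows "summable (\<lambda>k. \<bar>a k\<bar>)" "(\<Sum>k. \<bar>a k\<bar>) \<le> 2 * K"
proof -
  have *: "(\<Sum>k<n. \<bar>a k\<bar>) \<le> 2 * K" for n
  proof -
    let ?P = "{k. k < n \<and> 0 \<le> a k}" and ?N = "{k. k < n \<and> a k < 0}"
    have "{..<n} = ?P \<union> ?N" by auto
    then have "(\<Sum>k<n. \<bar>a k\<bar>) = (\<Sum>k\<in>?P \<union> ?N. \<bar>a k\<bar>)" by (rule arg_cong)
    also have "\<dots> = (\<Sum>k\<in>?P. \<bar>a k\<bar>) + (\<Sum>k\<in>?N. \<bar>a k\<bar>)"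
      by (rule sum.union_disjoint) auto
    also have "\<dots> = sum a ?P - sum a ?N"
      by (simp add: sum_negf[symmetric])
    also have "\<dots> \<le> 2 * K"
      using assms[of ?P] assms[of ?N] by simp
    finally show ?thesis .
  qed
  show "summable (\<lambda>k. \<bar>a k\<bar>)"
    by (rule summableI_nonneg_bounded[OF _ *]) simp
  then show "(\<Sum>k. \<bar>a k\<bar>) \<le> 2 * K"
    by (rule suminf_le_const) (rule *)
qed

text \<open>The hypothesis says that \<open>x \<mapsto> (D k x)\<^sub>k\<close> maps the space boundedly into \<open>\<ell>\<^sub>1\<close> and hits the unit
  vectors along a bounded sequence, so it is onto: the space has the separable nonreflexive quotient
  \<open>\<ell>\<^sub>1\<close>. The tails \<open>\<phi> n = (\<Sum>k\<ge>n. D k)\<close> tend to 0 pointwise, being tails of convergent series.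
  They do not tend to 0 weakly: \<open>\<phi> n (v k) = 1\<close> as soon as \<open>k \<ge> n\<close>, so a limit of the evaluations at
  \<open>v k\<close> along a filter finer than \<open>k \<rightarrow> \<infinity>\<close> is a functional on the dual with value 1 at every \<open>\<phi> n\<close>.\<close>

lemma not_Grothendieck_of_l1_quotient:
  fixes D :: "nat \<Rightarrow> 'a::banach \<Rightarrow>\<^sub>L real" and v :: "nat \<Rightarrow> 'a"
  assumes D: "\<And>A x. finite A \<Longrightarrow> \<bar>\<Sum>k\<in>A. D k x\<bar> \<le> K * norm x"
    and v: "\<And>k. norm (v k) \<le> B"
    and Dv: "\<And>j k. D j (v k) = (if j = k then 1 else 0)"
  shows "\<not> Grothendieck_space TYPE('a)"
proof
  assume Gr: "Grothendieck_space TYPE('a)"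
  have abs_D: "summable (\<lambda>k. \<bar>D k x\<bar>)" "(\<Sum>k. \<bar>D k x\<bar>) \<le> 2 * (K * norm x)" for x
    using summable_abs_of_bounded_finite_sums[of "\<lambda>k. D k x", OF D] by auto
  have D_sum: "summable (\<lambda>k. D k x)" for x
    using abs_D(1) by (rule summable_rabs_cancel)
  have D_tail: "summable (\<lambda>k. D (k + n) x)" for n x
    using D_sum by (rule summable_ignore_initial_segment)
  define t where "t n x = (\<Sum>k. D (k + n) x)" for n x
  have t: "t n x = (\<Sum>k. D k x) - (\<Sum>k<n. D k x)" for n x
    unfolding t_def by (rule suminf_minus_initial_segment[OF D_sum])
  have "bounded_linear (t n)" for n
  proof (rule bounded_linear_intro)
    show "t n (x + y) = t n x + t n y" for x y
      unfolding t_def by (simp add: blinfun.add_right suminf_add[OF D_tail D_tail])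
    show "t n (c *\<^sub>R x) = c *\<^sub>R t n x" for c x
      unfolding t_def by (simp add: blinfun.scaleR_right suminf_mult[OF D_tail])
    show "norm (t n x) \<le> norm x * (3 * K)" for x
    proof -
      have "\<bar>\<Sum>k. D k x\<bar> \<le> 2 * (K * norm x)"
        using summable_rabs[OF abs_D(1)[of x]] abs_D(2)[of x] by simp
      moreover have "\<bar>\<Sum>k<n. D k x\<bar> \<le> K * norm x"
        by (rule D) simp
      moreover have "norm x * (3 * K) = 3 * (K * norm x)" by simp
      ultimately show ?thesis unfolding t real_norm_def by linarith
    qed
  qed
  then have \<phi>: "blinfun_apply (Blinfun (t n)) = t n" for n
    by (rule bounded_linear_Blinfun_apply)
  define \<phi> where "\<phi> n = Blinfun (t n)" for n
  note \<phi> = \<phi>[folded \<phi>_def]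
  have weak_star: "(\<lambda>n. \<phi> n x) \<longlonglongrightarrow> 0" for x
    unfolding \<phi> t
    using tendsto_diff[OF tendsto_const[of "\<Sum>k. D k x"] summable_LIMSEQ[OF D_sum[of x]]] by simp
  then have "limitin weak_star_topology \<phi> 0 sequentially"
    by (simp add: limitin_weak_star_topology_iff)
  then obtain \<psi> where \<psi>: "limitin weak_topology \<phi> \<psi> sequentially"
    using Gr unfolding Grothendieck_space_def by blast
  have "\<psi> x = 0" for x
  proof (rule LIMSEQ_unique)
    define ev where "ev = Blinfun (\<lambda>\<zeta> :: 'a \<Rightarrow>\<^sub>L real. \<zeta> x)"
    have ev: "ev \<zeta> = \<zeta> x" for \<zeta>
      unfolding ev_def by (simp add: bounded_linear_Blinfun_apply blinfun.bounded_linear_left)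
    have "(\<lambda>n. ev (\<phi> n)) \<longlonglongrightarrow> ev \<psi>"
      using \<psi> unfolding limitin_weak_topology_iff by blast
    then show "(\<lambda>n. \<phi> n x) \<longlonglongrightarrow> \<psi> x"
      by (simp add: ev)
  qed (rule weak_star)
  then have "\<psi> = 0" by (intro blinfun_eqI) simp
  obtain G where G: "G \<le> sequentially" "G \<noteq> bot"
    "\<And>s :: nat \<Rightarrow> real. bounded (range s) \<Longrightarrow> \<exists>l. (s \<longlongrightarrow> l) G"
    using finer_filter_bounded_functions_converge[of sequentially] by auto
  have "\<bar>\<zeta> (v k)\<bar> \<le> B * norm \<zeta>" for k and \<zeta> :: "'a \<Rightarrow>\<^sub>L real"
    using norm_blinfun[of \<zeta> "v k"] mult_left_mono[OF v[of k], of "norm \<zeta>"]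
    by (simp add: mult.commute)
  moreover have "linear (\<lambda>\<zeta> :: 'a \<Rightarrow>\<^sub>L real. \<zeta> (v k))" for k
    using blinfun.bounded_linear_left by (rule bounded_linear.linear)
  ultimately obtain U :: "('a \<Rightarrow>\<^sub>L real) \<Rightarrow>\<^sub>L real"
    where U: "\<And>\<zeta>. ((\<lambda>k. blinfun_apply \<zeta> (v k)) \<longlongrightarrow> U \<zeta>) G"
    using limit_of_bounded_functionals[of G "\<lambda>k \<zeta>. blinfun_apply \<zeta> (v k)" B, OF G(2,3)] by blast
  have "\<phi> n (v k) = 1" if "n \<le> k" for n k
    using that unfolding \<phi> t
    by (simp add: Dv sums_unique[OF sums_single[of k "\<lambda>_. 1 :: real"], symmetric])
  then have "eventually (\<lambda>k. \<phi> n (v k) = 1) sequentially" for n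
    unfolding eventually_sequentially by blast
  then have "eventually (\<lambda>k. \<phi> n (v k) = 1) G" for n
    using G(1) by (rule filter_leD[rotated])
  then have "((\<lambda>k. \<phi> n (v k)) \<longlongrightarrow> 1) G" for n
    by (rule tendsto_eventually)
  then have "U (\<phi> n) = 1" for n
    using tendsto_unique[OF G(2) U] by blast
  moreover have "(\<lambda>n. U (\<phi> n)) \<longlonglongrightarrow> U \<psi>"
    using \<psi> unfolding limitin_weak_topology_iff by blast
  ultimately show False
    using \<open>\<psi> = 0\<close> by (simp add: LIMSEQ_const_iff)
qed


section \<open>Averages over lattice boxes\<close>

text \<open>The average of \<open>g\<close> over the lattice points of the box \<open>{0..<N}\<^sup>m\<close>, extended by zero to sequences.
  It is an iterated average, one coordinate at a time, so that the effect of a shift in one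
  coordinate can be computed by telescoping in that coordinate alone.\<close>

primrec box_avg :: "nat \<Rightarrow> nat \<Rightarrow> ((nat \<Rightarrow> nat) \<Rightarrow> real) \<Rightarrow> real" where
  "box_avg N 0 g = g (\<lambda>_. 0)"
| "box_avg N (Suc m) g = box_avg N m (\<lambda>z. (\<Sum>j<N. g (z(m := j))) / N)"

lemma box_avg_add: "box_avg N m (\<lambda>z. g z + h z) = box_avg N m g + box_avg N m h"
  by (induction m arbitrary: g h) (simp_all add: sum.distrib add_divide_distrib)

lemma box_avg_cmult: "box_avg N m (\<lambda>z. c * g z) = c * box_avg N m g"
proof (induction m arbitrary: g)
  case (Suc m)
  show ?case
    using Suc[of "\<lambda>z. (\<Sum>j<N. g (z(m := j))) / N"] by (simp flip: sum_distrib_left)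
qed simp

lemma box_avg_diff: "box_avg N m (\<lambda>z. g z - h z) = box_avg N m g - box_avg N m h"
  using box_avg_add[of N m g "\<lambda>z. -1 * h z"] by (simp only: box_avg_cmult) simp

lemma box_avg_const: "0 < N \<Longrightarrow> box_avg N m (\<lambda>z. c) = c"
  by (induction m) simp_all

lemma box_avg_cong:
  assumes "\<And>z. (\<And>i. i < m \<Longrightarrow> z i < N) \<Longrightarrow> g z = h z"
  shows "box_avg N m g = box_avg N m h"
  using assms
proof (induction m arbitrary: g h)
  case (Suc m)
  have "g (z(m := j)) = h (z(m := j))" if "\<And>i. i < m \<Longrightarrow> z i < N" "j < N" for z j
    by (rule Suc.prems) (use that in \<open>auto simp: less_Suc_eq\<close>)
  then have "(\<Sum>j<N. g (z(m := j))) / N = (\<Sum>j<N. h (z(m := j))) / N"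
    if "\<And>i. i < m \<Longrightarrow> z i < N" for z
    using that by (intro arg_cong2[where f = "(/)"] sum.cong) simp_all
  then show ?case
    unfolding box_avg.simps by (rule Suc.IH)
qed simp

lemma abs_box_avg_le:
  assumes "0 < N" "\<And>z. \<bar>g z\<bar> \<le> B"
  shows "\<bar>box_avg N m g\<bar> \<le> B"
  using assms(2)
proof (induction m arbitrary: g)
  case (Suc m)
  have "\<bar>(\<Sum>j<N. g (z(m := j))) / N\<bar> \<le> B" for z
    using order_trans[OF sum_abs sum_bounded_above[of "{..<N}" "\<lambda>j. \<bar>g (z(m := j))\<bar>" B]]
      Suc.prems \<open>0 < N\<close>
    by (simp add: abs_divide field_simps)
  then show ?case by (simp add: Suc.IH)
qed simp

definition raise :: "nat set \<Rightarrow> (nat \<Rightarrow> nat) \<Rightarrow> nat \<Rightarrow> nat" where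
  "raise A z i = (if i \<in> A then Suc (z i) else z i)"

text \<open>After a shift in one direction, the sums over the box and over the shifted box differ only in two
  opposite faces, and each face carries a fraction \<open>1 / N\<close> of the points.\<close>

lemma box_avg_raise_single:
  assumes "0 < N" "k < m" "\<And>z. \<bar>g z\<bar> \<le> B"
  shows "\<bar>box_avg N m (\<lambda>z. g (raise {k} z)) - box_avg N m g\<bar> \<le> 2 * B / N"
  using assms(2,3)
proof (induction m arbitrary: g)
  case (Suc m)
  show ?case
  proof (cases "k = m")
    case True
    have "raise {m} (z(m := j)) = z(m := Suc j)" for z j
      by (auto simp: raise_def)
    then have "box_avg N (Suc m) (\<lambda>z. g (raise {k} z)) - box_avg N (Suc m) g
        = box_avg N m (\<lambda>z. (\<Sum>j<N. g (z(m := Suc j)) - g (z(m := j))) / N)"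
      using True by (simp add: sum_subtractf diff_divide_distrib flip: box_avg_diff)
    also have "\<dots> = box_avg N m (\<lambda>z. (g (z(m := N)) - g (z(m := 0))) / N)"
      by (simp only: sum_lessThan_telescope[of "\<lambda>j. g (_(m := j))"])
    also have "\<bar>\<dots>\<bar> \<le> 2 * B / N"
    proof (rule abs_box_avg_le[OF assms(1)])
      fix z
      have "\<bar>g (z(m := N)) - g (z(m := 0))\<bar> \<le> 2 * B"
        using Suc.prems(2)[of "z(m := N)"] Suc.prems(2)[of "z(m := 0)"] by linarith
      then show "\<bar>(g (z(m := N)) - g (z(m := 0))) / N\<bar> \<le> 2 * B / N"
        by (simp add: abs_divide divide_right_mono)
    qed
    finally show ?thesis .
  next
    case False
    define h where "h z = (\<Sum>j<N. g (z(m := j))) / N" for z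
    have "raise {k} (z(m := j)) = (raise {k} z)(m := j)" for z j
      using False by (auto simp: raise_def)
    then have "box_avg N (Suc m) (\<lambda>z. g (raise {k} z)) = box_avg N m (\<lambda>z. h (raise {k} z))"
      by (simp add: h_def)
    moreover have "box_avg N (Suc m) g = box_avg N m h"
      by (simp add: h_def[abs_def])
    moreover have "\<bar>h z\<bar> \<le> B" for z
      unfolding h_def
      using order_trans[OF sum_abs sum_bounded_above[of "{..<N}" "\<lambda>j. \<bar>g (z(m := j))\<bar>" B]]
        Suc.prems \<open>0 < N\<close>
      by (simp add: abs_divide field_simps)
    ultimately show ?thesis
      using Suc.IH[of h] Suc.prems(1) False by simp
  qed
qed simp

lemma raise_empty [simp]: "raise {} z = z"
  by (simp add: raise_def fun_eq_iff)

lemma raise_insert: "k \<notin> A \<Longrightarrow> raise (insert k A) z = raise {k} (raise A z)"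
  by (auto simp: raise_def)

lemma box_avg_raise:
  assumes "0 < N" "finite A" "A \<subseteq> {..<m}" "\<And>z. \<bar>g z\<bar> \<le> B"
  shows "\<bar>box_avg N m (\<lambda>z. g (raise A z)) - box_avg N m g\<bar> \<le> card A * (2 * B / N)"
  using assms(2,3)
proof induction
  case (insert k A)
  have "raise (insert k A) z = raise A (raise {k} z)" for z
    using insert.hyps by (auto simp: raise_def)
  then have "\<bar>box_avg N m (\<lambda>z. g (raise (insert k A) z)) - box_avg N m (\<lambda>z. g (raise A z))\<bar> \<le> 2 * B / N"
    using box_avg_raise_single[of N k m "\<lambda>z. g (raise A z)" B] assms insert.prems by simp
  then show ?case
    using insert.IH insert.prems insert.hyps by (simp add: distrib_right add_divide_distrib)
qed simp

text \<open>Approximate translation invariance makes averaged increments almost additive in the direction: in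
  a path from \<open>z\<close> to \<open>raise A z\<close> that raises one coordinate after the other, the increment in
  direction \<open>k\<close> is taken at a shifted point, which hardly matters on average. In the application
  \<open>B\<close> is of order \<open>1 / N\<close>, so that the error is of smaller order than the increments.\<close>

lemma box_avg_increment_additive:
  assumes "0 < N" "finite A" "A \<subseteq> {..<m}" "\<And>k z. \<bar>g (raise {k} z) - g z\<bar> \<le> B"
  shows "\<bar>box_avg N m (\<lambda>z. g (raise A z) - g z)
      - (\<Sum>k\<in>A. box_avg N m (\<lambda>z. g (raise {k} z) - g z))\<bar>
    \<le> (real (card A))\<^sup>2 * (2 * B / N)"
  using assms(2,3)
proof induction
  case empty
  show ?case using box_avg_const[OF assms(1), of m 0] by simp
next
  case (insert k A)
  define h where "h z = g (raise {k} z) - g z" for z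
  define c where "c = 2 * B / N"
  have "0 \<le> c"
    using order_trans[OF abs_ge_zero assms(4)] by (simp add: c_def)
  have "g (raise (insert k A) z) - g z = (g (raise A z) - g z) + h (raise A z)" for z
    unfolding h_def raise_insert[OF insert.hyps(2)] by simp
  then have "box_avg N m (\<lambda>z. g (raise (insert k A) z) - g z)
      = box_avg N m (\<lambda>z. g (raise A z) - g z) + box_avg N m (\<lambda>z. h (raise A z))"
    by (simp only: box_avg_add)
  moreover have "\<bar>box_avg N m (\<lambda>z. h (raise A z)) - box_avg N m h\<bar> \<le> card A * c"
    unfolding c_def using insert assms by (intro box_avg_raise) (auto simp: h_def)
  moreover have "\<bar>box_avg N m (\<lambda>z. g (raise A z) - g z)
      - (\<Sum>k\<in>A. box_avg N m (\<lambda>z. g (raise {k} z) - g z))\<bar>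
    \<le> (real (card A))\<^sup>2 * c"
    unfolding c_def using insert by simp
  moreover have "(\<Sum>k\<in>insert k A. box_avg N m (\<lambda>z. g (raise {k} z) - g z))
     = box_avg N m h + (\<Sum>k\<in>A. box_avg N m (\<lambda>z. g (raise {k} z) - g z))"
    using insert.hyps by (simp add: h_def[abs_def])
  moreover have "(real (card A))\<^sup>2 * c + card A * c \<le> (real (card (insert k A)))\<^sup>2 * c"
    using \<open>0 \<le> c\<close> insert.hyps by (simp add: power2_eq_square algebra_simps)
  ultimately show ?case
    unfolding c_def[symmetric] by linarith
qed


section \<open>Averaged partial derivatives on the sphere of \<open>c\<^sub>0\<close>\<close>

text \<open>The leading 1 and the truncation keep the point on the sphere for every \<open>z\<close>, not only for the
  grid points of the cube, so that Lipschitz estimates apply without conditions on \<open>z\<close>.\<close>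

definition sphere_point :: "nat \<Rightarrow> (nat \<Rightarrow> nat) \<Rightarrow> nat \<Rightarrow>\<^sub>C real" where
  "sphere_point m z =
    Bcontfun (\<lambda>n. case n of 0 \<Rightarrow> 1 | Suc i \<Rightarrow> if i < m then min 1 (z i / m) else 0)"

lemma sphere_point_apply:
  "apply_bcontfun (sphere_point m z) n = (case n of 0 \<Rightarrow> 1 | Suc i \<Rightarrow> if i < m then min 1 (z i / m) else 0)"
proof -
  have "(\<lambda>n. case n of 0 \<Rightarrow> 1 | Suc i \<Rightarrow> if i < m then min 1 (z i / m) else 0) \<in> bcontfun"
    by (rule bcontfun_normI[where b = 1]) (auto split: nat.split)
  then show ?thesis
    by (simp add: sphere_point_def Bcontfun_inverse)
qed

lemma sphere_point_in_sphere: "sphere_point m z \<in> c0_unit_sphere"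
proof -
  have "eventually (\<lambda>n. apply_bcontfun (sphere_point m z) n = 0) sequentially"
    unfolding eventually_sequentially
    by (rule exI[of _ "Suc m"]) (auto simp: sphere_point_apply split: nat.split)
  then have "sphere_point m z \<in> c0"
    unfolding c0_def by (simp add: tendsto_eventually)
  moreover have "norm (sphere_point m z) = 1"
  proof (rule antisym)
    show "norm (sphere_point m z) \<le> 1"
      by (rule norm_bound) (auto simp: sphere_point_apply split: nat.split)
    show "1 \<le> norm (sphere_point m z)"
      using norm_bounded[of "sphere_point m z" 0] by (simp add: sphere_point_apply)
  qed
  ultimately show ?thesis by (simp add: c0_unit_sphere_def)
qed

text \<open>The sup norm enters here: raising many coordinates costs no more than raising one.\<close>

lemma dist_sphere_point_raise_le: "dist (sphere_point m (raise A z)) (sphere_point m z) \<le> 1 / m"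
proof (rule dist_bound)
  fix n
  have *: "\<bar>min 1 a - min 1 b\<bar> \<le> \<bar>a - b\<bar>" for a b :: real by auto
  show "dist (apply_bcontfun (sphere_point m (raise A z)) n) (apply_bcontfun (sphere_point m z) n)
      \<le> 1 / m"
  proof (cases n)
    case (Suc i)
    have "\<bar>raise A z i / m - z i / m\<bar> \<le> 1 / m"
      by (auto simp: raise_def simp flip: diff_divide_distrib)
    with *[of "raise A z i / m" "z i / m"] show ?thesis
      by (auto simp: Suc sphere_point_apply dist_real_def)
  qed (simp add: sphere_point_apply)
qed

text \<open>Mesh \<open>1 / m\<close> and dimension \<open>m\<close> are tied together, so that one limit refines the grid and exhausts
  the coordinates at once. A fixed finite set of directions is negligible against the \<open>m\<close> grid
  points on each side of the box, which is all that the error estimates need.\<close>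

definition mean_slope :: "nat \<Rightarrow> nat \<Rightarrow> ((nat \<Rightarrow>\<^sub>C real) \<Rightarrow> real) \<Rightarrow> real" where
  "mean_slope m k F =
    m * box_avg m m (\<lambda>z. F (sphere_point m (raise {k} z)) - F (sphere_point m z))"

lemma mean_slope_add: "mean_slope m k (\<lambda>x. F x + H x) = mean_slope m k F + mean_slope m k H"
  unfolding mean_slope_def box_avg_diff box_avg_add by (simp add: algebra_simps)

lemma mean_slope_cmult: "mean_slope m k (\<lambda>x. c * F x) = c * mean_slope m k F"
  unfolding mean_slope_def box_avg_diff box_avg_cmult by (simp add: algebra_simps)

lemma increment_sphere_point_le:
  assumes "L-lipschitz_on c0_unit_sphere F"
  shows "\<bar>F (sphere_point m (raise A z)) - F (sphere_point m z)\<bar> \<le> L / m"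
proof -
  have "\<bar>F (sphere_point m (raise A z)) - F (sphere_point m z)\<bar>
      \<le> L * dist (sphere_point m (raise A z)) (sphere_point m z)"
    using lipschitz_onD[OF assms sphere_point_in_sphere sphere_point_in_sphere]
    by (simp add: dist_real_def)
  also have "\<dots> \<le> L * (1 / m)"
    by (rule mult_left_mono[OF dist_sphere_point_raise_le lipschitz_on_nonneg[OF assms]])
  finally show ?thesis by simp
qed

lemma abs_mean_slope_le:
  assumes "L-lipschitz_on c0_unit_sphere F"
  shows "\<bar>mean_slope m k F\<bar> \<le> L"
proof (cases "m = 0")
  case True
  then show ?thesis using lipschitz_on_nonneg[OF assms] by (simp add: mean_slope_def)
next
  case False
  then show ?thesis
    using abs_box_avg_le[OF _ increment_sphere_point_le[OF assms, where A = "{k}"], of m m m]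
    by (simp add: mean_slope_def abs_mult field_simps)
qed

text \<open>Up to an error that vanishes as \<open>m \<rightarrow> \<infinity>\<close>, the sum of the slopes over \<open>A\<close> is the mean slope in
  the single direction \<open>\<Sum>k\<in>A. e\<^sub>k\<close>, a unit vector in the sup norm. Hence the bound does not grow
  with \<open>A\<close>, and the sequence of limiting slopes is in \<open>\<ell>\<^sub>1\<close>.\<close>

lemma abs_sum_mean_slope_le:
  assumes F: "L-lipschitz_on c0_unit_sphere F" and A: "finite A" "A \<subseteq> {..<m}" and "0 < m"
  shows "\<bar>\<Sum>k\<in>A. mean_slope m k F\<bar> \<le> L + (real (card A))\<^sup>2 * (2 * L) / m"
proof -
  define g where "g z = F (sphere_point m z)" for z
  define S where "S = (\<Sum>k\<in>A. box_avg m m (\<lambda>z. g (raise {k} z) - g z))"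
  have g: "\<bar>g (raise E z) - g z\<bar> \<le> L / m" for E z
    unfolding g_def by (rule increment_sphere_point_le[OF F])
  have "\<bar>box_avg m m (\<lambda>z. g (raise A z) - g z)\<bar> \<le> L / m"
    by (rule abs_box_avg_le[OF \<open>0 < m\<close> g])
  moreover have "\<bar>box_avg m m (\<lambda>z. g (raise A z) - g z) - S\<bar>
      \<le> (real (card A))\<^sup>2 * (2 * (L / m) / m)"
    unfolding S_def by (rule box_avg_increment_additive[where g = g, OF \<open>0 < m\<close> A g])
  ultimately have "\<bar>S\<bar> \<le> L / m + (real (card A))\<^sup>2 * (2 * (L / m) / m)"
    by linarith
  then have "m * \<bar>S\<bar> \<le> m * (L / m + (real (card A))\<^sup>2 * (2 * (L / m) / m))"
    by (rule mult_left_mono) simp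
  also have "\<dots> = L + (real (card A))\<^sup>2 * (2 * L) / m"
    using \<open>0 < m\<close> by (simp add: distrib_left)
  finally show ?thesis
    by (simp add: mean_slope_def S_def g_def abs_mult flip: sum_distrib_left)
qed

text \<open>The constant \<open>b\<close> leaves room for the normalisation at the base point.\<close>

lemma mean_slope_coordinate:
  assumes F: "\<And>x. x \<in> c0_unit_sphere \<Longrightarrow> F x = apply_bcontfun x (Suc k) + b" and "j < m" "k < m"
  shows "mean_slope m j F = (if j = k then 1 else 0)"
proof -
  have "box_avg m m (\<lambda>z. F (sphere_point m (raise {j} z)) - F (sphere_point m z))
      = box_avg m m (\<lambda>z. if j = k then 1 / m else 0)"
  proof (rule box_avg_cong)
    fix z :: "nat \<Rightarrow> nat"
    assume "\<And>i. i < m \<Longrightarrow> z i < m"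
    \<comment> \<open>The truncation in \<open>sphere_point\<close> is inactive here, also after the raise.\<close>
    with \<open>k < m\<close> have z: "Suc (z k) \<le> m" by (simp add: Suc_leI)
    then have "real (Suc (z k)) / m \<le> 1" "real (z k) / m \<le> 1"
      by (simp_all add: divide_le_eq_1)
    then show "F (sphere_point m (raise {j} z)) - F (sphere_point m z)
        = (if j = k then 1 / m else 0)"
      using \<open>k < m\<close> by (simp add: F sphere_point_in_sphere sphere_point_apply raise_def
        flip: diff_divide_distrib)
  qed
  then show ?thesis
    using \<open>k < m\<close> by (simp add: mean_slope_def box_avg_const)
qed


section \<open>Lipschitz functions on spaces containing the sphere\<close>

text \<open>McShane's extension formula, for a function on the image of \<open>\<phi>\<close> given through the parameter.\<close>

lemma lipschitz_extension:
  fixes h :: "'b \<Rightarrow> real" and \<phi> :: "'b \<Rightarrow> 'a::metric_space"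
  assumes "S \<noteq> {}" "0 \<le> K" "\<And>x y. x \<in> S \<Longrightarrow> y \<in> S \<Longrightarrow> \<bar>h x - h y\<bar> \<le> K * dist (\<phi> x) (\<phi> y)"
  obtains g where "K-lipschitz_on UNIV g" "\<And>x. x \<in> S \<Longrightarrow> g (\<phi> x) = h x"
proof -
  define g where "g x = (INF y\<in>S. h y + K * dist x (\<phi> y))" for x
  obtain y0 where y0: "y0 \<in> S" using assms(1) by blast
  have bdd: "bdd_below ((\<lambda>y. h y + K * dist x (\<phi> y)) ` S)" for x
  proof (rule bdd_belowI2)
    fix y assume "y \<in> S"
    have "h y0 - h y \<le> K * dist (\<phi> y0) (\<phi> y)"
      using assms(3)[OF y0 \<open>y \<in> S\<close>] by simp
    also have "\<dots> \<le> K * (dist x (\<phi> y0) + dist x (\<phi> y))"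
      by (intro mult_left_mono assms(2) dist_triangle3)
    finally show "h y0 - K * dist x (\<phi> y0) \<le> h y + K * dist x (\<phi> y)"
      by (simp add: algebra_simps)
  qed
  have le: "g x \<le> g x' + K * dist x x'" for x x'
  proof -
    have "g x - K * dist x x' \<le> h y + K * dist x' (\<phi> y)" if "y \<in> S" for y
    proof -
      have "g x \<le> h y + K * dist x (\<phi> y)"
        unfolding g_def by (rule cINF_lower[OF bdd that])
      also have "\<dots> \<le> h y + K * (dist x x' + dist x' (\<phi> y))"
        by (intro add_left_mono mult_left_mono assms(2) dist_triangle)
      finally show ?thesis by (simp add: algebra_simps)
    qed
    then have "g x - K * dist x x' \<le> g x'"
      unfolding g_def[of x'] using assms(1) by (intro cINF_greatest)
    then show ?thesis by simp
  qed
  show thesis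
  proof
    show "K-lipschitz_on UNIV g"
    proof (rule lipschitz_onI)
      show "dist (g x) (g y) \<le> K * dist x y" for x y
        using le[of x y] le[of y x] by (simp add: dist_real_def abs_le_iff dist_commute)
    qed (rule assms(2))
    fix x assume "x \<in> S"
    show "g (\<phi> x) = h x"
    proof (rule antisym)
      show "g (\<phi> x) \<le> h x"
        using cINF_lower[OF bdd \<open>x \<in> S\<close>, of "\<phi> x"] by (simp add: g_def)
      show "h x \<le> g (\<phi> x)"
        unfolding g_def using assms(1)
      proof (rule cINF_greatest)
        show "h x \<le> h y + K * dist (\<phi> x) (\<phi> y)" if "y \<in> S" for y
          using assms(3)[OF \<open>x \<in> S\<close> that] by simp
      qed
    qed
  qed
qed

lemma lip0_apply_add: "lip0_apply (f + g) x = lip0_apply f x + lip0_apply g x"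
  by transfer simp

lemma lip0_apply_scaleR: "lip0_apply (r *\<^sub>R f) x = r * lip0_apply f x"
  by transfer simp

lemma lip0_of_lipschitz:
  fixes g :: "'a::pointed_metric_space \<Rightarrow> real"
  assumes "K-lipschitz_on UNIV g"
  obtains f where "\<And>x. lip0_apply f x = g x - g base_point" "norm f \<le> K"
proof -
  have "K-lipschitz_on UNIV (\<lambda>x. g x - g base_point)"
    using assms by (simp add: lipschitz_on_def dist_real_def)
  then obtain f where f: "lip0_apply f = (\<lambda>x. g x - g base_point)"
    using Lip0_inverse[of "\<lambda>x. g x - g base_point"] by auto
  moreover have "norm f \<le> K"
    using lipschitz_on_nonneg[OF assms] lipschitz_onD[OF assms]
    by (intro norm_lip0_le) (auto simp: f dist_real_def)
  ultimately show thesis by (intro that[of f]) simp_all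
qed

theorem corollary5p20:
  assumes "\<exists>\<phi> :: (nat \<Rightarrow>\<^sub>C real) \<Rightarrow> 'm::pointed_metric_space. bilipschitz_embedding_on c0_unit_sphere \<phi>"
  shows "\<not> Grothendieck_space TYPE('m lip0)"
proof -
  let ?S = c0_unit_sphere
  obtain \<phi> :: "(nat \<Rightarrow>\<^sub>C real) \<Rightarrow> 'm" and c C where "0 < c" "0 < C"
    and lower: "\<And>x y. x \<in> ?S \<Longrightarrow> y \<in> ?S \<Longrightarrow> c * dist x y \<le> dist (\<phi> x) (\<phi> y)"
    and upper: "\<And>x y. x \<in> ?S \<Longrightarrow> y \<in> ?S \<Longrightarrow> dist (\<phi> x) (\<phi> y) \<le> C * dist x y"
    using assms unfolding bilipschitz_embedding_on_def by blast
  obtain G where G: "G \<le> sequentially" "G \<noteq> bot"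
    "\<And>s :: nat \<Rightarrow> real. bounded (range s) \<Longrightarrow> \<exists>l. (s \<longlongrightarrow> l) G"
    using finer_filter_bounded_functions_converge[of sequentially] by auto
  define T where "T k m f = mean_slope m k (\<lambda>x. lip0_apply f (\<phi> x))" for k m and f :: "'m lip0"
  have lip: "(C * norm f)-lipschitz_on ?S (\<lambda>x. lip0_apply f (\<phi> x))" for f :: "'m lip0"
  proof (rule lipschitz_onI)
    fix x y assume xy: "x \<in> ?S" "y \<in> ?S"
    have "dist (lip0_apply f (\<phi> x)) (lip0_apply f (\<phi> y)) \<le> norm f * dist (\<phi> x) (\<phi> y)"
      unfolding dist_real_def by (rule lip0_lipschitz)
    also have "\<dots> \<le> norm f * (C * dist x y)"
      by (intro mult_left_mono upper xy norm_ge_zero)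
    finally show "dist (lip0_apply f (\<phi> x)) (lip0_apply f (\<phi> y)) \<le> C * norm f * dist x y"
      by (simp add: mult_ac)
  qed (use \<open>0 < C\<close> in simp)
  have "\<exists>U :: 'm lip0 \<Rightarrow>\<^sub>L real. \<forall>f. ((\<lambda>m. T k m f) \<longlongrightarrow> U f) G" for k
  proof -
    have "linear (T k m)" for m
      by (rule linearI)
        (simp_all add: T_def lip0_apply_add lip0_apply_scaleR mean_slope_add mean_slope_cmult)
    moreover have "\<bar>T k m f\<bar> \<le> C * norm f" for m f
      unfolding T_def by (rule abs_mean_slope_le[OF lip])
    ultimately show ?thesis
      using limit_of_bounded_functionals[of G "T k" C, OF G(2,3)] by blast
  qed
  then obtain D :: "nat \<Rightarrow> 'm lip0 \<Rightarrow>\<^sub>L real" where D: "\<And>k f. ((\<lambda>m. T k m f) \<longlongrightarrow> D k f) G"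
    using choice[of "\<lambda>k U. \<forall>f. ((\<lambda>m. T k m f) \<longlongrightarrow> blinfun_apply U f) G"] by blast
  have D_bound: "\<bar>\<Sum>k\<in>A. D k f\<bar> \<le> C * norm f" if fin: "finite A" for A f
  proof (rule tendsto_le[OF G(2)])
    let ?err = "\<lambda>m. (real (card A))\<^sup>2 * (2 * (C * norm f)) / real m"
    show "((\<lambda>m. \<bar>\<Sum>k\<in>A. T k m f\<bar>) \<longlongrightarrow> \<bar>\<Sum>k\<in>A. D k f\<bar>) G"
      by (intro tendsto_rabs tendsto_sum D)
    have "?err \<longlonglongrightarrow> 0" by (rule lim_const_over_n)
    then have "(\<lambda>m. C * norm f + ?err m) \<longlonglongrightarrow> C * norm f"
      using tendsto_add[OF tendsto_const[of "C * norm f"], of ?err 0] by simp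
    then show "((\<lambda>m. C * norm f + ?err m) \<longlongrightarrow> C * norm f) G"
      using G(1) by (rule tendsto_mono[rotated])
    obtain n where n: "A \<subseteq> {..<n}" using finite_nat_bounded[OF fin] by blast
    have "eventually (\<lambda>m. \<bar>\<Sum>k\<in>A. T k m f\<bar> \<le> C * norm f + ?err m) sequentially"
      using eventually_ge_at_top[of n] eventually_gt_at_top[of 0]
    proof eventually_elim
      case (elim m)
      with n have "A \<subseteq> {..<m}" by auto
      with elim show ?case
        unfolding T_def by (intro abs_sum_mean_slope_le lip fin)
    qed
    then show "eventually (\<lambda>m. \<bar>\<Sum>k\<in>A. T k m f\<bar> \<le> C * norm f + ?err m) G"
      using G(1) by (rule filter_leD[rotated])
  qed
  have "\<exists>f :: 'm lip0. norm f \<le> 1 / c \<and> (\<forall>j. D j f = (if j = k then 1 else 0))" for k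
  proof -
    have "\<bar>apply_bcontfun x (Suc k) - apply_bcontfun y (Suc k)\<bar> \<le> 1 / c * dist (\<phi> x) (\<phi> y)"
      if "x \<in> ?S" "y \<in> ?S" for x y
    proof -
      have "\<bar>apply_bcontfun x (Suc k) - apply_bcontfun y (Suc k)\<bar> \<le> dist x y"
        using dist_bounded[of x "Suc k" y] by (simp add: dist_real_def)
      also have "\<dots> \<le> 1 / c * dist (\<phi> x) (\<phi> y)"
        using lower[OF that] \<open>0 < c\<close> by (simp add: field_simps)
      finally show ?thesis .
    qed
    moreover have "?S \<noteq> {}" using sphere_point_in_sphere by blast
    ultimately obtain g where g: "(1 / c)-lipschitz_on UNIV g"
      "\<And>x. x \<in> ?S \<Longrightarrow> g (\<phi> x) = apply_bcontfun x (Suc k)"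
      using lipschitz_extension[of ?S "1 / c" "\<lambda>x. apply_bcontfun x (Suc k)" \<phi>] \<open>0 < c\<close>
      by (metis divide_nonneg_pos zero_le_one)
    obtain f :: "'m lip0"
      where f: "\<And>x. lip0_apply f x = g x - g base_point" "norm f \<le> 1 / c"
      using lip0_of_lipschitz[OF g(1)] by blast
    have "D j f = (if j = k then 1 else 0)" for j
    proof (rule tendsto_unique[OF G(2) D tendsto_eventually])
      have "eventually (\<lambda>m. T j m f = (if j = k then 1 else 0)) sequentially"
        using eventually_gt_at_top[of j] eventually_gt_at_top[of k]
      proof eventually_elim
        case (elim m)
        then show ?case
          unfolding T_def
          by (intro mean_slope_coordinate[where b = "- g base_point"]) (simp_all add: f g)
      qed
      then show "eventually (\<lambda>m. T j m f = (if j = k then 1 else 0)) G"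
        using G(1) by (rule filter_leD[rotated])
    qed
    with f(2) show ?thesis by blast
  qed
  then obtain v :: "nat \<Rightarrow> 'm lip0" where
    "\<And>k. norm (v k) \<le> 1 / c" "\<And>j k. D j (v k) = (if j = k then 1 else 0)"
    using choice[of "\<lambda>k f. norm f \<le> 1 / c \<and> (\<forall>j. blinfun_apply (D j) f = (if j = k then 1 else 0))"]
    by blast
  with D_bound show ?thesis
    by (rule not_Grothendieck_of_l1_quotient)
qed

end
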